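(* Let $\kappa$ be an uncountable cardinal with $\kappa^{<\kappa}=\kappa$. Suppose either $S=S^\kappa_\lambda$ for some regular cardinal $\lambda<\kappa$, or $S=\mathrm{reg}(\kappa)$ and $\kappa$ is weakly compact. If $\kappa$ has the $S$-dual diamond, then $E^{\kappa,\kappa}_S\le_c E^{2,\kappa}_{reg}$.
   Context: $S^\kappa_\lambda=\{\alpha<\kappa\mid\mathrm{cf}(\alpha)=\lambda\}$, $\mathrm{reg}(\kappa)=\{\alpha<\kappa\mid\alpha\text{ regular cardinal}\}$. For stationary $S\subseteq\kappa$, $\kappa$ has the $S$-dual diamond if there is a sequence $\langle f_\alpha\rangle_{\alpha<\kappa}$ with $f_\alpha:\alpha\to\alpha$ such that for every pair $(Z,g)$ with $Z\subseteq S$ stationary and $g\in\kappa^\kappa$, the set $\{\alpha\in\mathrm{reg}(\kappa)\mid g\restriction\alpha=f_\alpha\text{ and }Z\cap\alpha\text{ is stationary in }\alpha\}$ is stationary. For $\ell\in\{2,\kappa\}$, $\ell^\kappa$ carries the bounded topology (basic open sets $[\zeta]=\{\eta\mid\zeta\subset\eta\}$, $\zeta\in\ell^{<\kappa}$), and for stationary $T\subseteq\kappa$, $E^{\ell,\kappa}_T=\{(\eta,\xi)\in\ell^\kappa\times\ell^\kappa\mid\{\alpha<\kappa\mid\eta(\alpha)\ne\xi(\alpha)\}\cap T\text{ is not stationary}\}$; $E^{2,\kappa}_{reg}$ denotes $E^{2,\kappa}_{\mathrm{reg}(\kappa)}$. $E_1\le_c E_2$ means there is a continuous map $f$ with $\eta\,E_1\,\xi\iff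 f(\eta)\,E_2\,f(\xi)$. *)

theory Defs
  imports "HOL-Analysis.Abstract_Topology" "HOL-Library.Ramsey" "HOL-Library.Countable_Set"
begin

unbundle cardinal_syntax

text \<open>
  The cardinal \<open>\<kappa>\<close> is modelled as a type \<open>'k\<close> of class \<open>wellorder\<close> whose order is a cardinal
  order (initial ordinal).  The elements \<open>\<alpha> :: 'k\<close> are the ordinals below \<open>\<kappa>\<close>; as a set of smaller
  ordinals, \<open>\<alpha>\<close> is \<open>{..<\<alpha>}\<close>, and \<open>\<kappa>\<close> itself is \<open>UNIV\<close>.
\<close>

definition kappa :: "'k::wellorder rel" where
  "kappa = {(x, y). x \<le> y}"

definition seg :: "'k::wellorder \<Rightarrow> 'k rel" where
  "seg \<alpha> = {(x, y). x \<le> y \<and> y < \<alpha>}"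

definition reg :: "'k::wellorder set" where
  "reg = {\<alpha>. Cinfinite (seg \<alpha>) \<and> regularCard (seg \<alpha>)}"

text \<open>
  Cofinality of \<open>\<alpha>\<close>: the least cardinality of a subset \<open>K\<close> cofinal in \<open>\<alpha>\<close>.  Cofinal sets are
  taken in the non-strict sense, so that every \<open>\<alpha>\<close> has one; the constant \<^const>\<open>cofinal\<close> of the
  library is strict and no subset of a successor ordinal satisfies it.
\<close>

definition cf :: "'k::wellorder \<Rightarrow> 'k" where
  "cf \<alpha> = (LEAST \<mu>. \<exists>K \<subseteq> {..<\<alpha>}. (\<forall>x<\<alpha>. \<exists>y\<in>K. x \<le> y) \<and> |K| =o |{..<\<mu>}| )"

definition cf_set :: "'k::wellorder \<Rightarrow> 'k set" where
  "cf_set \<mu> = {\<alpha>. cf \<alpha> = \<mu>}"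

text \<open>
  Closed unbounded and stationary subsets of \<open>A\<close>, where \<open>A\<close> is \<open>\<kappa>\<close> (\<open>UNIV\<close>) or some limit \<open>\<alpha> < \<kappa>\<close>
  (\<open>{..<\<alpha>}\<close>).  In the closure condition, \<open>C\<close> is unbounded in \<open>\<delta>\<close> and \<open>\<delta> \<noteq> 0\<close>; this forces \<open>\<delta>\<close> to
  be a limit.
\<close>

definition club_in :: "'k::wellorder set \<Rightarrow> 'k set \<Rightarrow> bool" where
  "club_in A C \<longleftrightarrow> C \<subseteq> A \<and> (\<forall>\<alpha>\<in>A. \<exists>\<gamma>\<in>C. \<alpha> \<le> \<gamma>) \<and>
     (\<forall>\<delta>\<in>A. (\<exists>\<beta>. \<beta> < \<delta>) \<and> (\<forall>\<beta><\<delta>. \<exists>\<gamma>\<in>C. \<beta> < \<gamma> \<and> \<gamma> < \<delta>) \<longrightarrow> \<delta> \<in> C)"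

definition stationary_in :: "'k::wellorder set \<Rightarrow> 'k set \<Rightarrow> bool" where
  "stationary_in A Z \<longleftrightarrow> Z \<subseteq> A \<and> (\<forall>C. club_in A C \<longrightarrow> Z \<inter> C \<noteq> {})"

text \<open>
  Weak compactness is the partition property \<open>\<kappa> \<rightarrow> (\<kappa>)\<^sup>2\<^sub>2\<close> for uncountable \<open>\<kappa>\<close>; the colouring is of
  the two-element subsets of \<open>\<kappa>\<close>.
\<close>

definition weakly_compact :: "'a rel \<Rightarrow> bool" where
  "weakly_compact r \<longleftrightarrow> Card_order r \<and> uncountable (Field r) \<and>
     (\<forall>c :: 'a set \<Rightarrow> bool. \<exists>H \<subseteq> Field r. |H| =o r \<and> (\<exists>i. \<forall>p \<in> nsets H 2. c p = i))"

text \<open>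
  The \<open>S\<close>-dual diamond, which presupposes that \<open>S\<close> is stationary.  The sequence is \<open>f\<close>, where
  \<open>f \<alpha>\<close> matters only on arguments below \<open>\<alpha>\<close>.
\<close>

definition dual_diamond :: "'k::wellorder set \<Rightarrow> bool" where
  "dual_diamond S \<longleftrightarrow> stationary_in UNIV S \<and>
     (\<exists>f :: 'k \<Rightarrow> 'k \<Rightarrow> 'k. (\<forall>\<alpha>. \<forall>\<beta><\<alpha>. f \<alpha> \<beta> < \<alpha>) \<and>
        (\<forall>Z g. Z \<subseteq> S \<and> stationary_in UNIV Z \<longrightarrow>
           stationary_in UNIV
             {\<alpha> \<in> reg. (\<forall>\<beta><\<alpha>. g \<beta> = f \<alpha> \<beta>) \<and> stationary_in {..<\<alpha>} (Z \<inter> {..<\<alpha>})}))"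

text \<open>
  The set \<open>\<ell>\<^bsup><\<kappa>\<^esup>\<close> of sequences of length less than \<open>\<kappa>\<close>, with \<open>\<ell>\<close> given as a type \<open>'l\<close>
  (\<open>bool\<close> for \<open>\<ell> = 2\<close>, and \<open>'k\<close> for \<open>\<ell> = \<kappa>\<close>).
\<close>

definition short_seqs :: "('k::wellorder \<rightharpoonup> 'l) set" where
  "short_seqs = {\<zeta>. \<exists>\<alpha>. dom \<zeta> = {..<\<alpha>}}"

definition basic_open :: "('k \<rightharpoonup> 'l) \<Rightarrow> ('k \<Rightarrow> 'l) set" where
  "basic_open \<zeta> = {\<eta>. \<zeta> \<subseteq>\<^sub>m (Some \<circ> \<eta>)}"

definition bounded_topology :: "('k::wellorder \<Rightarrow> 'l) topology" where
  "bounded_topology = topology_generated_by (basic_open ` short_seqs)"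

definition E_rel :: "'k::wellorder set \<Rightarrow> ('k \<Rightarrow> 'l) rel" where
  "E_rel T = {(\<eta>, \<xi>). \<not> stationary_in UNIV ({\<alpha>. \<eta> \<alpha> \<noteq> \<xi> \<alpha>} \<inter> T)}"

definition continuously_reducible ::
    "('k::wellorder \<Rightarrow> 'a) rel \<Rightarrow> ('k \<Rightarrow> 'b) rel \<Rightarrow> bool" (infix \<open>\<le>\<^sub>c\<close> 50) where
  "E\<^sub>1 \<le>\<^sub>c E\<^sub>2 \<longleftrightarrow> (\<exists>f. continuous_map bounded_topology bounded_topology f \<and>
     (\<forall>\<eta> \<xi>. (\<eta>, \<xi>) \<in> E\<^sub>1 \<longleftrightarrow> (f \<eta>, f \<xi>) \<in> E\<^sub>2))"

end

theory Submission
  imports Defs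
begin

text \<open>
  Fix a dual diamond sequence \<open>f\<close> and let \<open>F \<eta> \<alpha>\<close> say that \<open>\<eta>\<close> and \<open>f \<alpha>\<close> agree on \<open>S\<close>, below \<open>\<alpha>\<close>,
  up to a nonstationary subset of \<open>\<alpha>\<close>.  As \<open>F \<eta> \<alpha>\<close> depends only on \<open>\<eta>\<close> below \<open>\<alpha>\<close>, \<open>F\<close> is
  continuous.  If \<open>\<eta>\<close> and \<open>\<xi>\<close> agree on \<open>S\<close> along a club \<open>C\<close>, then \<open>F \<eta> \<alpha> = F \<xi> \<alpha>\<close> at every
  uncountable regular \<open>\<alpha>\<close> that is a limit of \<open>C\<close>, because clubs of such \<open>\<alpha>\<close> are closed under
  intersection.  Otherwise \<open>Z = {\<alpha> \<in> S. \<eta> \<alpha> \<noteq> \<xi> \<alpha>}\<close> is stationary, and the dual diamond for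
  \<open>(Z, \<eta>)\<close> yields stationarily many regular \<open>\<alpha>\<close> at which \<open>F \<eta> \<alpha>\<close> holds and \<open>F \<xi> \<alpha>\<close> fails.
\<close>

lemma stationary_in_mono:
  assumes "stationary_in A Z" "Z \<subseteq> Y" "Y \<subseteq> A"
  shows "stationary_in A Y"
  using assms unfolding stationary_in_def by blast

lemma not_stationary_in_empty: "\<not> stationary_in A {}"
proof -
  have "club_in A A" unfolding club_in_def by blast
  then show ?thesis unfolding stationary_in_def by blast
qed

section \<open>The bounded topology\<close>

lemma topspace_bounded_topology: "topspace bounded_topology = UNIV"
proof -
  have "(Map.empty :: 'a \<rightharpoonup> 'b) \<in> short_seqs"
    unfolding short_seqs_def
    by (auto intro!: exI[of _ "LEAST x. True"] dest: not_less_Least)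
  moreover have "basic_open (Map.empty :: 'a \<rightharpoonup> 'b) = UNIV"
    by (simp add: basic_open_def)
  ultimately show ?thesis
    unfolding bounded_topology_def topology_generated_by_topspace by blast
qed

text \<open>Whether \<open>F \<eta>\<close> extends a sequence of length \<gamma> is decided by the
  values of \<eta> below \<gamma>, so the preimage contains, with \<eta>, the basic neighbourhood of
  all functions agreeing with \<eta> below \<gamma>.\<close>

lemma continuous_map_bounded_topology:
  fixes F :: "('k::wellorder \<Rightarrow> 'a) \<Rightarrow> 'k \<Rightarrow> 'b"
  assumes local: "\<And>\<eta> \<xi> \<alpha>. (\<And>\<beta>. \<beta> < \<alpha> \<Longrightarrow> \<eta> \<beta> = \<xi> \<beta>) \<Longrightarrow> F \<eta> \<alpha> = F \<xi> \<alpha>"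
  shows "continuous_map bounded_topology bounded_topology F"
proof -
  have "openin bounded_topology (F -` basic_open \<zeta>)" if "\<zeta> \<in> short_seqs" for \<zeta> :: "'k \<rightharpoonup> 'b"
  proof -
    obtain \<gamma> where \<gamma>: "dom \<zeta> = {..<\<gamma>}"
      using \<open>\<zeta> \<in> short_seqs\<close> unfolding short_seqs_def by blast
    define N where "N \<eta> = basic_open ((Some \<circ> \<eta>) |` {..<\<gamma>})" for \<eta> :: "'k \<Rightarrow> 'a"
    have N_iff: "\<xi> \<in> N \<eta> \<longleftrightarrow> (\<forall>\<beta><\<gamma>. \<eta> \<beta> = \<xi> \<beta>)" for \<xi> \<eta>
      by (auto simp: N_def basic_open_def map_le_def restrict_map_def split: if_splits)
    have "openin bounded_topology (N \<eta>)" for \<eta>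
      unfolding bounded_topology_def N_def
      by (intro topology_generated_by_Basis imageI)
         (auto simp: short_seqs_def restrict_map_def dom_def intro!: exI[of _ \<gamma>]
           split: if_splits)
    moreover have "N \<eta> \<subseteq> F -` basic_open \<zeta>" if "F \<eta> \<in> basic_open \<zeta>" for \<eta>
    proof
      fix \<xi> assume "\<xi> \<in> N \<eta>"
      then have "F \<eta> \<alpha> = F \<xi> \<alpha>" if "\<alpha> < \<gamma>" for \<alpha>
        using that by (intro local) (auto simp: N_iff)
      then show "\<xi> \<in> F -` basic_open \<zeta>"
        using that \<gamma> by (auto simp: basic_open_def map_le_def)
    qed
    moreover have "\<eta> \<in> N \<eta>" for \<eta>
      by (simp add: N_iff)
    ultimately show ?thesis
      by (subst openin_subopen) (metis vimage_eq)
  qed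
  moreover have "\<Union> (basic_open ` short_seqs) = (UNIV :: ('k \<Rightarrow> 'b) set)"
    using topspace_bounded_topology[where 'a = 'k and 'b = 'b]
    unfolding bounded_topology_def topology_generated_by_topspace .
  ultimately show ?thesis
    unfolding bounded_topology_def[where 'l = 'b]
    by (intro continuous_on_generated_topo) (auto simp: topspace_bounded_topology)
qed

section \<open>Regular cardinals below \<kappa>\<close>

lemma Field_seg: "Field (seg \<alpha>) = {..<\<alpha>}"
  by (auto simp: seg_def Field_def)

lemma reg_strict_upper_bound:
  assumes "\<alpha> \<in> reg" "\<beta> < \<alpha>"
  shows "\<exists>\<gamma><\<alpha>. \<beta> < \<gamma>"
proof -
  have "Card_order (seg \<alpha>)" "infinite (Field (seg \<alpha>))"
    using assms by (auto simp: reg_def cinfinite_def)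
  then obtain \<gamma> where "\<gamma> \<in> Field (seg \<alpha>)" "\<beta> \<noteq> \<gamma>" "(\<beta>, \<gamma>) \<in> seg \<alpha>"
    using infinite_Card_order_limit[of "seg \<alpha>" \<beta>] assms by (auto simp: Field_seg)
  then show ?thesis by (auto simp: seg_def intro!: exI[of _ \<gamma>])
qed

lemma countable_iff_card_of_nat: "countable A \<longleftrightarrow> |A| \<le>o |UNIV :: nat set|"
  unfolding countable_def by (simp flip: card_of_ordLeq)

text \<open>A proper initial segment of a cardinal has smaller cardinality, whereas a countable
  \<alpha> would inject into the infinite segment below \<omega>. This discards the first infinite
  cardinal, in which two clubs can be disjoint.\<close>

lemma reg_uncountable:
  assumes "\<alpha> \<in> reg" "\<omega> < \<alpha>" "infinite {..<\<omega>}"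
  shows "uncountable {..<\<alpha>}"
proof
  assume "countable {..<\<alpha>}"
  have "Card_order (seg \<alpha>)"
    using assms by (auto simp: reg_def)
  then have "|underS (seg \<alpha>) \<omega>| <o |{..<\<alpha>}|"
    using card_of_underS[of "seg \<alpha>" \<omega>] card_of_Field_ordIso[of "seg \<alpha>"] assms
    by (auto simp: Field_seg intro: ordLess_ordIso_trans ordIso_symmetric)
  moreover have "underS (seg \<alpha>) \<omega> = {..<\<omega>}"
    using assms by (auto simp: underS_def seg_def)
  moreover have "|{..<\<alpha>}| \<le>o |{..<\<omega>}|"
    using \<open>countable {..<\<alpha>}\<close> assms(3) ordLeq_transitive
    unfolding countable_iff_card_of_nat infinite_iff_card_of_nat by blast
  ultimately show False
    using not_ordLess_ordLeq by auto
qed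

text \<open>An unbounded \<open>K\<close> would be cofinal, so regularity would give it the
  cardinality of \<alpha>.\<close>

lemma reg_countable_bounded:
  assumes "\<alpha> \<in> reg" "uncountable {..<\<alpha>}" "K \<subseteq> {..<\<alpha>}" "countable K"
  shows "\<exists>\<beta><\<alpha>. \<forall>x\<in>K. x \<le> \<beta>"
proof (rule ccontr)
  assume unbounded: "\<not> ?thesis"
  have "cofinal K (seg \<alpha>)"
    unfolding cofinal_def Field_seg
  proof
    fix \<beta> assume "\<beta> \<in> {..<\<alpha>}"
    then obtain x where "x \<in> K" "\<not> x \<le> \<beta>" using unbounded by auto
    then show "\<exists>b\<in>K. \<beta> \<noteq> b \<and> (\<beta>, b) \<in> seg \<alpha>"
      using assms(3) by (auto simp: seg_def intro!: bexI[of _ x])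
  qed
  then have "|K| =o seg \<alpha>"
    using assms(1,3) by (auto simp: reg_def regularCard_def Field_seg)
  moreover have "|{..<\<alpha>}| =o seg \<alpha>"
    using card_of_Field_ordIso[of "seg \<alpha>"] assms(1) by (auto simp: reg_def Field_seg)
  ultimately have "|{..<\<alpha>}| =o |K|"
    using ordIso_symmetric ordIso_transitive by blast
  then have "countable {..<\<alpha>}"
    using assms(4) ordIso_ordLeq_trans unfolding countable_iff_card_of_nat by blast
  with assms(2) show False by simp
qed

section \<open>Clubs in regular cardinals and in \<kappa>\<close>

text \<open>Unboundedness is the point: choose elements of \<open>C\<close> and \<open>D\<close>
  alternately, \<omega> many times. The supremum stays below \<alpha> because countable sets are
  bounded there, and it is a limit of both clubs.\<close>

lemma club_in_Int:
  assumes \<alpha>: "\<alpha> \<in> reg" "uncountable {..<\<alpha>}"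
    and C: "club_in {..<\<alpha>} C" and D: "club_in {..<\<alpha>} D"
  shows "club_in {..<\<alpha>} (C \<inter> D)"
  unfolding club_in_def
proof (intro conjI ballI impI)
  show "C \<inter> D \<subseteq> {..<\<alpha>}" using C by (auto simp: club_in_def)
next
  fix \<delta>
  assume "\<delta> \<in> {..<\<alpha>}" "(\<exists>\<beta>. \<beta> < \<delta>) \<and> (\<forall>\<beta><\<delta>. \<exists>\<gamma>\<in>C \<inter> D. \<beta> < \<gamma> \<and> \<gamma> < \<delta>)"
  then have "\<delta> \<in> B" if "B = C \<or> B = D" for B
    using that C D \<open>\<delta> \<in> {..<\<alpha>}\<close> unfolding club_in_def by (metis Int_iff)
  then show "\<delta> \<in> C \<inter> D" by blast
next
  fix \<beta> assume "\<beta> \<in> {..<\<alpha>}"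
  have above: "\<exists>\<gamma>\<in>B. x < \<gamma>" if "club_in {..<\<alpha>} B" "x < \<alpha>" for B x
    using reg_strict_upper_bound[OF \<alpha>(1) that(2)] that(1)
    unfolding club_in_def by (meson lessThan_iff less_le_trans)
  have step: "\<exists>y. (y < \<alpha>) \<and> (\<exists>c\<in>C. \<exists>d\<in>D. x < c \<and> c < d \<and> d < y)" if "x < \<alpha>" for x
  proof -
    obtain c where "c \<in> C" "x < c" using above[OF C \<open>x < \<alpha>\<close>] by auto
    moreover from this have "c < \<alpha>" using C by (auto simp: club_in_def)
    moreover from this obtain d where "d \<in> D" "c < d" using above[OF D] by auto
    moreover from this have "d < \<alpha>" using D by (auto simp: club_in_def)
    ultimately show ?thesis using reg_strict_upper_bound[OF \<alpha>(1)] by metis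
  qed
  \<comment> \<open>Two consecutive terms of the sequence enclose an element of each club.\<close>
  let ?R = "\<lambda>x y. \<exists>c\<in>C. \<exists>d\<in>D. x < c \<and> c < d \<and> d < y"
  have "\<exists>s. \<forall>n. (s n < \<alpha> \<and> (n = 0 \<longrightarrow> s n = \<beta>)) \<and> ?R (s n) (s (Suc n))"
    by (rule dependent_nat_choice) (use step \<open>\<beta> \<in> {..<\<alpha>}\<close> in auto)
  then obtain s where s0: "s 0 = \<beta>" and s: "\<And>n. s n < \<alpha>" "\<And>n. ?R (s n) (s (Suc n))"
    by blast
  \<comment> \<open>The supremum of the sequence; it lies below \<alpha> because some bound
    \<delta>' does.\<close>
  define \<delta> where "\<delta> = (LEAST \<delta>. \<forall>n. s n \<le> \<delta>)"
  obtain \<delta>' where "\<delta>' < \<alpha>" "\<forall>n. s n \<le> \<delta>'"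
    using reg_countable_bounded[OF \<alpha>, of "range s"] s(1) by auto
  then have "\<delta> \<le> \<delta>'" and ub: "s n \<le> \<delta>" for n
    using LeastI[of "\<lambda>\<delta>. \<forall>n. s n \<le> \<delta>" \<delta>'] unfolding \<delta>_def
    by (blast intro: Least_le)+
  then have "\<delta> < \<alpha>" using \<open>\<delta>' < \<alpha>\<close> by simp
  \<comment> \<open>Strict growth means that the supremum is not attained, so \<delta> is a
    limit.\<close>
  have "s n < s (Suc n)" for n using s(2) by (meson less_trans)
  then have lt: "s n < \<delta>" for n using ub by (meson less_le_trans)
  have lub: "\<exists>n. x < s n" if "x < \<delta>" for x
    using not_less_Least[of x "\<lambda>\<delta>. \<forall>n. s n \<le> \<delta>"] that by (auto simp: \<delta>_def not_le)
  have "\<exists>c\<in>C. \<exists>d\<in>D. x < c \<and> c < \<delta> \<and> x < d \<and> d < \<delta>" if "x < \<delta>" for x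
  proof -
    obtain n where n: "x < s n" using lub \<open>x < \<delta>\<close> by blast
    obtain c d where "c \<in> C" "d \<in> D" "s n < c" "c < d" "d < s (Suc n)" using s(2) by blast
    moreover have "s (Suc n) < \<delta>" by (rule lt)
    ultimately show ?thesis using n by (meson less_trans)
  qed
  then have "\<forall>x<\<delta>. \<exists>b\<in>B. x < b \<and> b < \<delta>" if "B = C \<or> B = D" for B
    using that by metis
  then have "\<delta> \<in> B" if "B = C \<or> B = D" for B
    using that C D lt \<open>\<delta> < \<alpha>\<close> unfolding club_in_def by (metis lessThan_iff)
  then have "\<delta> \<in> C \<inter> D" by blast
  moreover have "\<beta> \<le> \<delta>" using ub[of 0] s0 by simp
  ultimately show "\<exists>\<gamma>\<in>C \<inter> D. \<beta> \<le> \<gamma>" by blast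
qed

text \<open>
  Cofinality of \<open>C\<close> in \<open>\<alpha>\<close> is taken in the non-strict sense, so that successors of elements of \<open>C\<close>
  count too; hence no assumption on the cofinality of \<open>\<kappa>\<close> is needed.
\<close>

lemma club_in_limit_points:
  fixes C :: "'k::wellorder set"
  assumes C: "club_in UNIV C" and no_top: "\<And>\<beta>::'k. \<exists>\<gamma>. \<beta> < \<gamma>"
  shows "club_in UNIV {\<alpha>. \<omega> < \<alpha> \<and> (\<forall>\<beta><\<alpha>. \<exists>\<gamma>\<in>C. \<beta> \<le> \<gamma> \<and> \<gamma> < \<alpha>)}" (is "club_in UNIV ?D")
  unfolding club_in_def
proof (intro conjI ballI impI)
  fix \<alpha> :: 'k
  obtain c where c: "c \<in> C" "max \<alpha> \<omega> \<le> c" using C unfolding club_in_def by blast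
  \<comment> \<open>The successor of \<open>c\<close>: everything below it is at most
    \<open>c\<close>, so \<open>c\<close> alone witnesses membership in \<open>?D\<close>.\<close>
  define c' where "c' = (LEAST x. c < x)"
  have "c < c'" using no_top[of c] unfolding c'_def by (auto intro: LeastI)
  moreover have "\<beta> \<le> c" if "\<beta> < c'" for \<beta>
    using not_less_Least[of \<beta> "\<lambda>x. c < x"] that by (auto simp: c'_def)
  ultimately have "c' \<in> ?D" using c by auto
  moreover have "\<alpha> \<le> c'" using c \<open>c < c'\<close> by auto
  ultimately show "\<exists>\<gamma>\<in>?D. \<alpha> \<le> \<gamma>" by blast
next
  fix \<delta>
  assume \<delta>: "(\<exists>\<beta>. \<beta> < \<delta>) \<and> (\<forall>\<beta><\<delta>. \<exists>\<gamma>\<in>?D. \<beta> < \<gamma> \<and> \<gamma> < \<delta>)"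
  then have "\<omega> < \<delta>" by (auto dest: less_trans)
  moreover have "\<exists>\<gamma>\<in>C. \<beta> \<le> \<gamma> \<and> \<gamma> < \<delta>" if "\<beta> < \<delta>" for \<beta>
  proof -
    obtain \<gamma> where \<gamma>: "\<gamma> \<in> ?D" "\<beta> < \<gamma>" "\<gamma> < \<delta>" using \<delta> \<open>\<beta> < \<delta>\<close> by blast
    then obtain c where "c \<in> C" "\<beta> \<le> c" "c < \<gamma>" by blast
    then show ?thesis using \<gamma>(3) by (meson less_trans)
  qed
  ultimately show "\<delta> \<in> ?D" by blast
qed auto

text \<open>Closure is inherited, since a limit of the elements of \<open>C\<close> below \<alpha>
  is a limit of \<open>C\<close>; \<open>lim\<close> supplies unboundedness.\<close>

lemma club_in_restrict:
  assumes C: "club_in UNIV C" and lim: "\<forall>\<beta><\<alpha>. \<exists>\<gamma>\<in>C. \<beta> \<le> \<gamma> \<and> \<gamma> < \<alpha>"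
  shows "club_in {..<\<alpha>} (C \<inter> {..<\<alpha>})"
  unfolding club_in_def
proof (intro conjI ballI impI)
  fix \<delta>
  assume \<delta>: "\<delta> \<in> {..<\<alpha>}"
    "(\<exists>\<beta>. \<beta> < \<delta>) \<and> (\<forall>\<beta><\<delta>. \<exists>\<gamma>\<in>C \<inter> {..<\<alpha>}. \<beta> < \<gamma> \<and> \<gamma> < \<delta>)"
  then have "(\<exists>\<beta>. \<beta> < \<delta>) \<and> (\<forall>\<beta><\<delta>. \<exists>\<gamma>\<in>C. \<beta> < \<gamma> \<and> \<gamma> < \<delta>)"
    by blast
  then have "\<delta> \<in> C"
    using C by (simp add: club_in_def)
  then show "\<delta> \<in> C \<inter> {..<\<alpha>}"
    using \<delta>(1) by blast
qed (use lim in auto)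

section \<open>The reduction\<close>

text \<open>This is the map \<open>F\<close> of the introduction. Ignoring nonstationary errors
  makes it insensitive to changes of \<eta> off a club of \<alpha>.\<close>

definition guess_map :: "'k::wellorder set \<Rightarrow> ('k \<Rightarrow> 'k \<Rightarrow> 'a) \<Rightarrow> ('k \<Rightarrow> 'a) \<Rightarrow> 'k \<Rightarrow> bool" where
  "guess_map S f \<eta> \<alpha> \<longleftrightarrow> \<not> stationary_in {..<\<alpha>} {\<beta> \<in> S. \<beta> < \<alpha> \<and> \<eta> \<beta> \<noteq> f \<alpha> \<beta>}"

lemma guess_map_cong:
  assumes "\<And>\<beta>. \<beta> < \<alpha> \<Longrightarrow> \<eta> \<beta> = \<xi> \<beta>"
  shows "guess_map S f \<eta> \<alpha> = guess_map S f \<xi> \<alpha>"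
proof -
  have "{\<beta> \<in> S. \<beta> < \<alpha> \<and> \<eta> \<beta> \<noteq> f \<alpha> \<beta>} = {\<beta> \<in> S. \<beta> < \<alpha> \<and> \<xi> \<beta> \<noteq> f \<alpha> \<beta>}"
    using assms by auto
  then show ?thesis by (simp add: guess_map_def)
qed

text \<open>If a club \<open>D\<close> avoids the errors of \<eta>, then \<open>C \<inter> D\<close>
  avoids those of \<xi>, and it is again a club.\<close>

lemma guess_map_transfer:
  assumes \<alpha>: "\<alpha> \<in> reg" "uncountable {..<\<alpha>}"
    and C: "club_in {..<\<alpha>} C" and eq: "\<And>\<beta>. \<beta> \<in> C \<inter> S \<Longrightarrow> \<eta> \<beta> = \<xi> \<beta>"
    and guess: "guess_map S f \<eta> \<alpha>"
  shows "guess_map S f \<xi> \<alpha>"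
proof -
  obtain D where D: "club_in {..<\<alpha>} D" "{\<beta> \<in> S. \<beta> < \<alpha> \<and> \<eta> \<beta> \<noteq> f \<alpha> \<beta>} \<inter> D = {}"
    using guess by (auto simp: guess_map_def stationary_in_def)
  have "{\<beta> \<in> S. \<beta> < \<alpha> \<and> \<xi> \<beta> \<noteq> f \<alpha> \<beta>} \<inter> (C \<inter> D) = {}"
    using D(2) eq by fastforce
  with club_in_Int[OF \<alpha> C D(1)] show ?thesis
    unfolding guess_map_def stationary_in_def by blast
qed

lemma E_rel_guess_map:
  fixes S :: "'k::wellorder set"
  assumes no_top: "\<And>\<beta>::'k. \<exists>\<gamma>. \<beta> < \<gamma>" and \<omega>: "infinite {..<\<omega>::'k}"
    and "(\<eta>, \<xi>) \<in> E_rel S"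
  shows "(guess_map S f \<eta>, guess_map S f \<xi>) \<in> E_rel reg"
proof -
  obtain C where C: "club_in UNIV C" and "({\<alpha>. \<eta> \<alpha> \<noteq> \<xi> \<alpha>} \<inter> S) \<inter> C = {}"
    using assms(3) by (auto simp: E_rel_def stationary_in_def)
  then have eq: "\<eta> \<beta> = \<xi> \<beta>" if "\<beta> \<in> C \<inter> S" for \<beta>
    using that by auto
  \<comment> \<open>The bound by \<omega> makes every regular element of \<open>D\<close>
    uncountable, as the intersection of clubs requires.\<close>
  define D where "D = {\<alpha>. \<omega> < \<alpha> \<and> (\<forall>\<beta><\<alpha>. \<exists>\<gamma>\<in>C. \<beta> \<le> \<gamma> \<and> \<gamma> < \<alpha>)}"
  have "club_in UNIV D"
    unfolding D_def by (rule club_in_limit_points[OF C no_top])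
  moreover have "guess_map S f \<eta> \<alpha> = guess_map S f \<xi> \<alpha>" if "\<alpha> \<in> D" "\<alpha> \<in> reg" for \<alpha>
  proof -
    have unc: "uncountable {..<\<alpha>}"
      using reg_uncountable[OF that(2) _ \<omega>] that(1) by (simp add: D_def)
    have club: "club_in {..<\<alpha>} (C \<inter> {..<\<alpha>})"
      using club_in_restrict[OF C] that(1) by (simp add: D_def)
    show ?thesis
      using guess_map_transfer[OF that(2) unc club, of S \<eta> \<xi> f]
        guess_map_transfer[OF that(2) unc club, of S \<xi> \<eta> f] eq by auto
  qed
  ultimately show ?thesis
    unfolding E_rel_def stationary_in_def by blast
qed

text \<open>The diamond is applied to \<eta> and the set \<open>Z\<close> of differences in
  \<open>S\<close>. Where it guesses, \<eta> has no errors at all, while every element of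
  \<open>Z\<close> below \<alpha> is an error of \<xi>.\<close>

lemma not_E_rel_guess_map:
  assumes diamond: "\<And>Z g. Z \<subseteq> S \<and> stationary_in UNIV Z \<Longrightarrow>
      stationary_in UNIV
        {\<alpha> \<in> reg. (\<forall>\<beta><\<alpha>. g \<beta> = f \<alpha> \<beta>) \<and> stationary_in {..<\<alpha>} (Z \<inter> {..<\<alpha>})}"
    and "(\<eta>, \<xi>) \<notin> E_rel S"
  shows "(guess_map S f \<eta>, guess_map S f \<xi>) \<notin> E_rel reg"
proof -
  define Z where "Z = {\<alpha>. \<eta> \<alpha> \<noteq> \<xi> \<alpha>} \<inter> S"
  define R where "R = {\<alpha> \<in> reg. (\<forall>\<beta><\<alpha>. \<eta> \<beta> = f \<alpha> \<beta>) \<and> stationary_in {..<\<alpha>} (Z \<inter> {..<\<alpha>})}"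
  have "stationary_in UNIV R"
    unfolding R_def using assms(2) by (intro diamond) (auto simp: Z_def E_rel_def)
  moreover have "guess_map S f \<eta> \<alpha> \<and> \<not> guess_map S f \<xi> \<alpha>" if "\<alpha> \<in> R" for \<alpha>
  proof
    have eq: "\<eta> \<beta> = f \<alpha> \<beta>" if "\<beta> < \<alpha>" for \<beta>
      using that \<open>\<alpha> \<in> R\<close> by (simp add: R_def)
    then have "{\<beta> \<in> S. \<beta> < \<alpha> \<and> \<eta> \<beta> \<noteq> f \<alpha> \<beta>} = {}" by auto
    then show "guess_map S f \<eta> \<alpha>"
      unfolding guess_map_def by (metis not_stationary_in_empty)
    have "stationary_in {..<\<alpha>} (Z \<inter> {..<\<alpha>})"
      using \<open>\<alpha> \<in> R\<close> by (simp add: R_def)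
    then have "stationary_in {..<\<alpha>} {\<beta> \<in> S. \<beta> < \<alpha> \<and> \<xi> \<beta> \<noteq> f \<alpha> \<beta>}"
      by (rule stationary_in_mono) (auto simp: Z_def simp flip: eq)
    then show "\<not> guess_map S f \<xi> \<alpha>"
      by (simp add: guess_map_def)
  qed
  then have "R \<subseteq> {\<alpha>. guess_map S f \<eta> \<alpha> \<noteq> guess_map S f \<xi> \<alpha>} \<inter> reg"
    by (auto simp: R_def)
  ultimately have "stationary_in UNIV ({\<alpha>. guess_map S f \<eta> \<alpha> \<noteq> guess_map S f \<xi> \<alpha>} \<inter> reg)"
    using stationary_in_mono by blast
  then show ?thesis by (simp add: E_rel_def)
qed

section \<open>The order type of \<kappa>\<close>

lemma card_order_kappa_no_top:
  assumes "card_order (kappa :: 'k::wellorder rel)" "infinite (UNIV :: 'k set)"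
  shows "\<exists>\<gamma>. (\<beta>::'k) < \<gamma>"
  using infinite_Card_order_limit[of "kappa :: 'k rel" \<beta>] assms
    card_order_on_Card_order[of UNIV "kappa :: 'k rel"]
  by (auto simp: kappa_def less_le)

text \<open>If all initial segments were finite, their sizes would inject the type into the natural
  numbers. Any point with infinitely many predecessors serves as \<omega>; it need not be the least
  one.\<close>

lemma infinite_lessThan_exists:
  assumes "uncountable (UNIV :: 'k::wellorder set)"
  shows "\<exists>\<omega>::'k. infinite {..<\<omega>}"
proof (rule ccontr)
  assume "\<not> ?thesis"
  then have fin: "finite {..<\<beta>}" for \<beta> :: 'k by simp
  have "inj (\<lambda>\<beta>::'k. card {..<\<beta>})"
  proof (rule linorder_injI)
    fix \<beta> \<gamma> :: 'k assume "\<beta> < \<gamma>"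
    then have "{..<\<beta>} \<subset> {..<\<gamma>}" by auto
    then have "card {..<\<beta>} < card {..<\<gamma>}" by (rule psubset_card_mono[OF fin])
    then show "card {..<\<beta>} \<noteq> card {..<\<gamma>}" by simp
  qed
  then show False using assms(1) countableI by blast
qed

theorem theorem3p3:
  fixes S :: "'k::wellorder set"
  assumes "card_order (kappa :: 'k rel)"
    and "uncountable (UNIV :: 'k set)"
    and "|short_seqs :: ('k \<rightharpoonup> 'k) set| =o (kappa :: 'k rel)"
    and "(\<exists>\<mu>\<in>reg. S = cf_set \<mu>) \<or> (S = reg \<and> weakly_compact (kappa :: 'k rel))"
    and "dual_diamond S"
  shows "(E_rel S :: ('k \<Rightarrow> 'k) rel) \<le>\<^sub>c (E_rel reg :: ('k \<Rightarrow> bool) rel)"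
proof -
  obtain f :: "'k \<Rightarrow> 'k \<Rightarrow> 'k" where diamond: "\<And>Z g. Z \<subseteq> S \<and> stationary_in UNIV Z \<Longrightarrow>
      stationary_in UNIV
        {\<alpha> \<in> reg. (\<forall>\<beta><\<alpha>. g \<beta> = f \<alpha> \<beta>) \<and> stationary_in {..<\<alpha>} (Z \<inter> {..<\<alpha>})}"
    using assms(5) unfolding dual_diamond_def by blast
  have no_top: "\<exists>\<gamma>. \<beta> < \<gamma>" for \<beta> :: 'k
    using card_order_kappa_no_top assms(1,2) countable_finite by blast
  obtain \<omega> :: 'k where \<omega>: "infinite {..<\<omega>}"
    using infinite_lessThan_exists[OF assms(2)] by blast
  have "continuous_map bounded_topology bounded_topology (guess_map S f)"
    by (rule continuous_map_bounded_topology) (rule guess_map_cong)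
  then show ?thesis
    unfolding continuously_reducible_def
    using E_rel_guess_map[OF no_top \<omega>] not_E_rel_guess_map[OF diamond] by blast
qed

end
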